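(* Let $\mathcal{R}$ be a ring with unity and let $b_1,b_2,c_1,c_2\in\mathcal{R}$ be regular. Let $g_i\in b_i\{1\}$ and $h_i\in c_i\{1\}$ ($i=1,2$) and suppose that $h_2c_2=b_1g_1$. Let $a_1,a_2\in\mathcal{R}$ and suppose that $a_i^{-(b_i,c_i)}$ exists ($i=1,2$). Then the following statements are equivalent. (i) $h_1c_1a_1(1-b_1g_1)a_2b_2g_2=0$. (ii) The element $a_1a_2$ satisfies the reverse order law, that is, $a_1a_2$ is $(b_2,c_1)$-invertible and $$(a_1a_2)^{-(b_2,\,c_1)}=a_2^{-(b_2,\,c_2)}a_1^{-(b_1,\,c_1)}.$$
   Context: An element $x$ of a ring $\mathcal{R}$ with unity is regular if there is $w\in\mathcal{R}$ with $x=xwx$; $x\{1\}$ denotes the set of all such $w$ (inner inverses of $x$). Given $b,c\in\mathcal{R}$, an element $a\in\mathcal{R}$ is $(b,c)$-invertible if there is $y\in\mathcal{R}$ with $y\in(b\mathcal{R}y)\cap(y\mathcal{R}c)$, $b=yab$ and $c=cay$. Such a $y$ is unique if it exists; it is denoted $a^{-(b,c)}$. *)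

theory Defs
  imports Main
begin

text \<open>Rings with unity are rendered by the sort \<open>{ring, monoid_mult}\<close> rather than
  \<open>ring_1\<close>, since the latter excludes the trivial ring (\<open>0 \<noteq> 1\<close>).\<close>

definition regular_elem :: "'a::{ring, monoid_mult} \<Rightarrow> bool" where
  "regular_elem x \<longleftrightarrow> (\<exists>w. x = x * w * x)"

definition inner_inverses :: "'a::{ring, monoid_mult} \<Rightarrow> 'a set" where
  "inner_inverses x = {w. x = x * w * x}"

definition is_bc_inverse :: "'a::{ring, monoid_mult} \<Rightarrow> 'a \<Rightarrow> 'a \<Rightarrow> 'a \<Rightarrow> bool" where
  "is_bc_inverse b c a y \<longleftrightarrow>
     y \<in> {b * r * y | r. True} \<inter> {y * r * c | r. True} \<and> b = y * a * b \<and> c = c * a * y"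

definition bc_invertible :: "'a::{ring, monoid_mult} \<Rightarrow> 'a \<Rightarrow> 'a \<Rightarrow> bool" where
  "bc_invertible b c a \<longleftrightarrow> (\<exists>y. is_bc_inverse b c a y)"

text \<open>Meaningful only if \<open>bc_invertible b c a\<close>; see \<open>bc_inv_eq\<close> below.\<close>

definition bc_inv :: "'a::{ring, monoid_mult} \<Rightarrow> 'a \<Rightarrow> 'a \<Rightarrow> 'a" where
  "bc_inv b c a = (THE y. is_bc_inverse b c a y)"

lemma is_bc_inverse_unique:
  assumes "is_bc_inverse b c a y" and "is_bc_inverse b c a z"
  shows "y = z"
proof -
  obtain s where s: "y = y * s * c" using assms(1) unfolding is_bc_inverse_def by blast
  obtain r where r: "z = b * r * z" using assms(2) unfolding is_bc_inverse_def by blast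
  have b: "b = y * a * b" and c: "c = c * a * z"
    using assms unfolding is_bc_inverse_def by blast+
  have "y = y * s * (c * a * z)" using s c by simp
  also have "\<dots> = (y * s * c) * a * z" by (simp add: mult.assoc)
  also have "\<dots> = y * a * z" using s by simp
  also have "\<dots> = y * a * (b * r * z)" using r by simp
  also have "\<dots> = (y * a * b) * r * z" by (simp add: mult.assoc)
  also have "\<dots> = z" using b r by simp
  finally show ?thesis .
qed

lemma bc_inv_eq:
  assumes "is_bc_inverse b c a y"
  shows "bc_inv b c a = y"
  unfolding bc_inv_def using assms is_bc_inverse_unique by (blast intro: the_equality)

end

theory Submission
  imports Defs
begin

text \<open>Write \<open>p = b1 g1 = h2 c2\<close>, \<open>y1 = a1\<^sup>-\<close> and \<open>y2 = a2\<^sup>-\<close>. Since \<open>y1\<close> and \<open>y2\<close> satisfy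
  \<open>p y1 = y1\<close>, \<open>y1 a1 p = p\<close>, \<open>y2 p = y2\<close>, \<open>p a2 y2 = p\<close>, the idempotent \<open>p\<close> can be inserted or
  absorbed next to them. The outer factors \<open>h1\<close> and \<open>g2\<close> of (i) cancel, so (i) says
  \<open>c1 a1 a2 b2 = c1 a1 p a2 b2\<close>, which is exactly what the equations \<open>b2 = y2 y1 a1 a2 b2\<close>
  and \<open>c1 = c1 a1 a2 y2 y1\<close> require.\<close>

lemma is_bc_inverseE:
  assumes "is_bc_inverse b c a y"
  obtains r s where "y = b * r * y" "y = y * s * c" "b = y * a * b" "c = c * a * y"
  using assms unfolding is_bc_inverse_def by blast

text \<open>By uniqueness, existence and value together amount to one predicate; this frees (ii) of
  the definite description.\<close>

lemma bc_inv_eq_iff: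
  "bc_invertible b c a \<and> bc_inv b c a = y \<longleftrightarrow> is_bc_inverse b c a y"
  unfolding bc_invertible_def using bc_inv_eq by blast

text \<open>Here \<open>y\<close> lies in \<open>b R\<close>, on which \<open>b * g\<close> acts as
  a left identity; the second law is \<open>b = y * a * b\<close> multiplied by \<open>g\<close> on
  the right.\<close>

lemma is_bc_inverse_absorb_left:
  fixes b g :: "'a::{ring, monoid_mult}"
  assumes "is_bc_inverse b c a y" and "g \<in> inner_inverses b"
  shows "b * g * y = y" and "y * a * (b * g) = b * g"
proof -
  obtain r where r: "y = b * r * y" and b: "b = y * a * b"
    using assms(1) by (rule is_bc_inverseE)
  have g: "b = b * g * b"
    using assms(2) by (simp add: inner_inverses_def)
  show "b * g * y = y"
    using r g by (metis mult.assoc)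
  show "y * a * (b * g) = b * g"
    using b by (metis mult.assoc)
qed

lemma is_bc_inverse_absorb_right:
  fixes c h :: "'a::{ring, monoid_mult}"
  assumes "is_bc_inverse b c a y" and "h \<in> inner_inverses c"
  shows "y * (h * c) = y" and "h * c * a * y = h * c"
proof -
  obtain s where s: "y = y * s * c" and c: "c = c * a * y"
    using assms(1) by (rule is_bc_inverseE)
  have h: "c = c * h * c"
    using assms(2) by (simp add: inner_inverses_def)
  show "y * (h * c) = y"
    using s h by (metis mult.assoc)
  show "h * c * a * y = h * c"
    using c by (metis mult.assoc)
qed

text \<open>Multiplying by \<open>c\<close> on the left and \<open>b\<close> on the right undoes
  \<open>h\<close> and \<open>g\<close>, because \<open>c * h * c = c\<close> and
  \<open>b * g * b = b\<close>.\<close>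

lemma inner_inverses_cancel_iff:
  fixes b c x g h :: "'a::{ring, monoid_mult}"
  assumes "g \<in> inner_inverses b" and "h \<in> inner_inverses c"
  shows "h * c * x * b * g = 0 \<longleftrightarrow> c * x * b = 0"
proof
  assume "h * c * x * b * g = 0"
  then have "c * (h * c * x * b * g) * b = 0"
    by simp
  moreover have "c * (h * c * x * b * g) * b = (c * h * c) * x * (b * g * b)"
    by (simp only: mult.assoc)
  moreover have "c * h * c = c" "b * g * b = b"
    using assms by (simp_all add: inner_inverses_def)
  ultimately show "c * x * b = 0"
    by simp
next
  assume "c * x * b = 0"
  then have "h * (c * x * b) * g = 0"
    by simp
  then show "h * c * x * b * g = 0"
    by (simp only: mult.assoc)
qed

lemma is_bc_inverse_mult_iff:
  fixes a1 a2 b1 b2 c1 c2 p y1 y2 :: "'a::{ring, monoid_mult}"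
  assumes y1: "is_bc_inverse b1 c1 a1 y1" and y2: "is_bc_inverse b2 c2 a2 y2"
    and p1: "p * y1 = y1" "y1 * a1 * p = p"
    and p2: "y2 * p = y2" "p * a2 * y2 = p"
  shows "is_bc_inverse b2 c1 (a1 * a2) (y2 * y1) \<longleftrightarrow> c1 * a1 * a2 * b2 = c1 * a1 * p * a2 * b2"
proof
  assume "is_bc_inverse b2 c1 (a1 * a2) (y2 * y1)"
  then have b2: "b2 = y2 * y1 * (a1 * a2) * b2"
    by (rule is_bc_inverseE)
  have c1: "c1 = c1 * a1 * y1"
    using y1 by (rule is_bc_inverseE)
  \<comment> \<open>Expanding \<open>b2\<close> creates the block \<open>p * a2 * y2\<close>, which
    collapses to \<open>p\<close> and is then absorbed by \<open>y1\<close>.\<close>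
  have "p * a2 * b2 = p * a2 * (y2 * y1 * (a1 * a2) * b2)"
    using b2 by simp
  also have "\<dots> = (p * a2 * y2) * y1 * a1 * a2 * b2"
    by (simp only: mult.assoc)
  also have "\<dots> = y1 * a1 * a2 * b2"
    by (simp only: p1 p2)
  finally have "c1 * a1 * (p * a2 * b2) = c1 * a1 * (y1 * a1 * a2 * b2)"
    by (rule arg_cong)
  also have "\<dots> = (c1 * a1 * y1) * a1 * a2 * b2"
    by (simp only: mult.assoc)
  also have "\<dots> = c1 * a1 * a2 * b2"
    using c1 by simp
  finally show "c1 * a1 * a2 * b2 = c1 * a1 * p * a2 * b2"
    by (simp only: mult.assoc)
next
  assume eq: "c1 * a1 * a2 * b2 = c1 * a1 * p * a2 * b2"
  obtain s where s: "y1 = y1 * s * c1" and c1: "c1 = c1 * a1 * y1"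
    using y1 by (rule is_bc_inverseE)
  obtain r where r: "y2 = b2 * r * y2" and b2: "b2 = y2 * a2 * b2"
    using y2 by (rule is_bc_inverseE)
  \<comment> \<open>Both membership conditions are inherited from the outer factors,
    \<open>y2\<close> on the left and \<open>y1\<close> on the right, without
    \<open>eq\<close>.\<close>
  have "y2 * y1 = b2 * r * (y2 * y1)"
    using r by (metis mult.assoc)
  moreover have "y2 * y1 = y2 * y1 * s * c1"
    using s by (metis mult.assoc)
  moreover have "b2 = y2 * y1 * (a1 * a2) * b2"
  proof -
    \<comment> \<open>Writing \<open>y1\<close> as \<open>y1 * s * c1\<close> exposes the
      \<open>c1\<close> needed to apply \<open>eq\<close>.\<close>
    have "y1 * a1 * a2 * b2 = y1 * s * (c1 * a1 * a2 * b2)"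
      using s by (metis mult.assoc)
    also have "\<dots> = (y1 * s * c1) * a1 * p * a2 * b2"
      unfolding eq by (simp only: mult.assoc)
    also have "\<dots> = p * a2 * b2"
      using s p1 by simp
    finally have "y2 * (y1 * a1 * a2 * b2) = (y2 * p) * a2 * b2"
      by (simp only: mult.assoc)
    then show ?thesis
      using b2 p2 by (simp add: mult.assoc)
  qed
  moreover have "c1 = c1 * (a1 * a2) * (y2 * y1)"
  proof -
    \<comment> \<open>Dually, \<open>y2 = b2 * r * y2\<close> supplies the \<open>b2\<close> needed
      for \<open>eq\<close>.\<close>
    have "c1 * (a1 * a2) * (y2 * y1) = (c1 * a1 * a2 * b2) * r * y2 * y1"
      using r by (metis mult.assoc)
    also have "\<dots> = c1 * a1 * p * a2 * (b2 * r * y2) * y1"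
      unfolding eq by (simp only: mult.assoc)
    also have "\<dots> = c1 * a1 * (p * a2 * y2) * y1"
      using r by (simp add: mult.assoc)
    also have "\<dots> = c1 * a1 * y1"
      unfolding p2 by (simp only: p1 mult.assoc)
    finally show ?thesis
      using c1 by simp
  qed
  ultimately show "is_bc_inverse b2 c1 (a1 * a2) (y2 * y1)"
    unfolding is_bc_inverse_def by blast
qed

theorem theorem6p2:
  fixes a1 a2 b1 b2 c1 c2 g1 g2 h1 h2 :: "'a::{ring, monoid_mult}"
  assumes "regular_elem b1" and "regular_elem b2"
    and "regular_elem c1" and "regular_elem c2"
    and "g1 \<in> inner_inverses b1" and "g2 \<in> inner_inverses b2"
    and "h1 \<in> inner_inverses c1" and "h2 \<in> inner_inverses c2"
    and "h2 * c2 = b1 * g1"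
    and "bc_invertible b1 c1 a1" and "bc_invertible b2 c2 a2"
  shows "h1 * c1 * a1 * (1 - b1 * g1) * a2 * b2 * g2 = 0
    \<longleftrightarrow> bc_invertible b2 c1 (a1 * a2)
        \<and> bc_inv b2 c1 (a1 * a2) = bc_inv b2 c2 a2 * bc_inv b1 c1 a1"
proof -
  let ?p = "b1 * g1" and ?y1 = "bc_inv b1 c1 a1" and ?y2 = "bc_inv b2 c2 a2"
  have y1: "is_bc_inverse b1 c1 a1 ?y1" and y2: "is_bc_inverse b2 c2 a2 ?y2"
    using assms(10,11) bc_inv_eq_iff by blast+
  note p1 = is_bc_inverse_absorb_left[OF y1 assms(5)]
  \<comment> \<open>The hypothesis \<open>h2 * c2 = b1 * g1\<close> enters here: it makes the
    idempotent absorbed by \<open>y2\<close> the same as the one absorbed by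
    \<open>y1\<close>.\<close>
  note p2 = is_bc_inverse_absorb_right[OF y2 assms(8), unfolded assms(9)]
  have "h1 * c1 * a1 * (1 - ?p) * a2 * b2 * g2 = 0
      \<longleftrightarrow> c1 * (a1 * (1 - ?p) * a2) * b2 = 0"
    using inner_inverses_cancel_iff[OF assms(6,7), of "a1 * (1 - ?p) * a2"]
    by (simp only: mult.assoc)
  also have "\<dots> \<longleftrightarrow> c1 * a1 * a2 * b2 = c1 * a1 * ?p * a2 * b2"
    by (simp add: algebra_simps)
  also have "\<dots> \<longleftrightarrow> is_bc_inverse b2 c1 (a1 * a2) (?y2 * ?y1)"
    using is_bc_inverse_mult_iff[OF y1 y2 p1 p2] by simp
  finally show ?thesis
    by (simp only: bc_inv_eq_iff)
qed

end
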